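(* Let $(X,\Phi)$ be an NAIFS of surjective continuous maps on a (non-empty) compact metric space $(X,d)$ without any isolated point. If $(X,\Phi)$ satisfies the specification property, then it has positive asymptotical topological entropy, $h^{\ast}(X,\Phi)>0$; in particular, $(X,\Phi)$ is topologically chaotic.
   Context: NAIFS: A non-autonomous iterated function system (NAIFS) of continuous maps on a compact space $X$ is a pair $(X,\Phi)$ where $\Phi=\{\Phi^{(j)}\}_{j\ge 1}$, $\Phi^{(j)}=\{\varphi_i^{(j)}:X\to X\}_{i\in I^{(j)}}$ is a collection of continuous maps and $I^{(j)}$ is a non-empty finite index set. It is of surjective maps if every $\varphi_i^{(j)}$ is surjective. For $m,n\ge1$ put $I^{m,n}:=\prod_{j=0}^{n-1}I^{(m+j)}$ and $I^{m,\infty}:=\prod_{j=m}^\infty I^{(j)}$ (finite and infinite words $w=w_mw_{m+1}\cdots$). For such a word and $k\ge 1$ (at most the length of $w$) put $\varphi_w^{m,k}:=\varphi_{w_{m+k-1}}^{(m+k-1)}\circ\cdots\circ\varphi_{w_m}^{(m)}$, $\varphi_w^{m,0}:=\mathrm{id}_X$, and $\varphi_w^{m,-k}(A):=(\varphi_w^{m,k})^{-1}(A)$ for sets $A$. Asymptotical entropy: For an open cover $\mathcal A$ of $X$ and $w\in I^{m,n}$ let $\mathcal A_w^{m,n}:=\bigvee_{j=0}^{n}\varphi_w^{m,-j}(\mathcal A)$, where $\varphi_w^{m,-j}(\mathcal A)=\{\varphi_w^{m,-j}(A):A\in\mathcal A\}$ and $\bigvee_i\mathcal A_i$ is the family of all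 intersections $\bigcap_i A_i$ with $A_i\in\mathcal A_i$; $\mathcal N(\cdot)$ denotes the minimal cardinality of a subcover. Let $\Phi_m=\{\Phi^{(j)}\}_{j\ge m}$ and $$h(X,\Phi_m;\mathcal A):=\limsup_{k\to\infty}\frac1k\log\Big(\frac1{\#(I^{m,k})}\sum_{w\in I^{m,k}}\mathcal N(\mathcal A_w^{m,k})\Big).$$ This is non-decreasing in $m$. Put $h^\ast(X,\Phi;\mathcal A):=\lim_{m\to\infty}h(X,\Phi_m;\mathcal A)$ and $h^\ast(X,\Phi):=\sup_{\mathcal A}h^\ast(X,\Phi;\mathcal A)$ over all open covers $\mathcal A$ of $X$. $(X,\Phi)$ is topologically chaotic if $h^\ast(X,\Phi)>0$. Specification property: for every $\delta>0$ there is $N(\delta)\in\mathbb N$ such that for each $w\in I^{1,\infty}$, any $x_1,\dots,x_s\in X$ with $s\ge2$ and any integers $0=j_1\le k_1<j_2\le k_2<\cdots<j_s\le k_s$ with $j_{n+1}-k_n\ge N(\delta)$ for $n=1,\dots,s-1$, there is $x\in X$ with $d(\varphi_w^{1,i}(x),\varphi_w^{1,i}(x_m))\le\delta$ for each $1\le m\le s$ and all $j_m\le i\le k_m$. *)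

theory Defs
  imports "HOL-Analysis.Analysis"
begin

text \<open>
  The space is a subset \<open>X\<close> of a topological (or metric) type, with the induced topology (metric).
  A system is given by index sets \<open>I j\<close> and maps \<open>\<phi> j i\<close> with \<open>i \<in> I j\<close>. Levels \<open>j\<close> start at 1;
  \<open>I 0\<close> and \<open>\<phi> 0\<close> are never used by a system considered from a level \<open>m \<ge> 1\<close> on.
\<close>

definition naifs :: "'a::topological_space set \<Rightarrow> (nat \<Rightarrow> 'i set) \<Rightarrow> (nat \<Rightarrow> 'i \<Rightarrow> 'a \<Rightarrow> 'a) \<Rightarrow> bool" where
  "naifs X I \<phi> \<longleftrightarrow> compact X \<and>
     (\<forall>j\<ge>1. finite (I j) \<and> I j \<noteq> {} \<and>
       (\<forall>i\<in>I j. continuous_on X (\<phi> j i) \<and> \<phi> j i ` X \<subseteq> X))"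

definition surjective_maps :: "'a set \<Rightarrow> (nat \<Rightarrow> 'i set) \<Rightarrow> (nat \<Rightarrow> 'i \<Rightarrow> 'a \<Rightarrow> 'a) \<Rightarrow> bool" where
  "surjective_maps X I \<phi> \<longleftrightarrow> (\<forall>j\<ge>1. \<forall>i\<in>I j. \<phi> j i ` X = X)"

text \<open>
  A word \<open>w\<^sub>m w\<^sub>m\<^sub>+\<^sub>1 \<dots>\<close> is a function on its absolute positions, so that \<open>w j \<in> I j\<close>. The extensional
  product makes finite words correspond one-to-one to such functions, so they can be counted.
\<close>

definition words :: "(nat \<Rightarrow> 'i set) \<Rightarrow> nat \<Rightarrow> nat \<Rightarrow> (nat \<Rightarrow> 'i) set" where
  "words I m n = PiE {m..<m + n} I"

definition inf_words :: "(nat \<Rightarrow> 'i set) \<Rightarrow> nat \<Rightarrow> (nat \<Rightarrow> 'i) set" where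
  "inf_words I m = PiE {m..} I"

primrec word_map :: "(nat \<Rightarrow> 'i \<Rightarrow> 'a \<Rightarrow> 'a) \<Rightarrow> nat \<Rightarrow> (nat \<Rightarrow> 'i) \<Rightarrow> nat \<Rightarrow> 'a \<Rightarrow> 'a" where
  "word_map \<phi> m w 0 = id"
| "word_map \<phi> m w (Suc k) = \<phi> (m + k) (w (m + k)) \<circ> word_map \<phi> m w k"

definition open_cover :: "'a::topological_space set \<Rightarrow> 'a set set \<Rightarrow> bool" where
  "open_cover X \<A> \<longleftrightarrow> (\<forall>A\<in>\<A>. openin (top_of_set X) A) \<and> \<Union>\<A> = X"

definition pullback_family :: "'a set \<Rightarrow> ('a \<Rightarrow> 'a) \<Rightarrow> 'a set set \<Rightarrow> 'a set set" where
  "pullback_family X f \<A> = (\<lambda>A. f -` A \<inter> X) ` \<A>"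

definition join_families :: "nat \<Rightarrow> (nat \<Rightarrow> 'a set set) \<Rightarrow> 'a set set" where
  "join_families n F = {\<Inter>j\<le>n. B j | B. \<forall>j\<le>n. B j \<in> F j}"

text \<open>
  The join runs over the \<open>n + 1\<close> times \<open>0, \<dots>, n\<close>.
\<close>

definition word_cover ::
  "'a set \<Rightarrow> (nat \<Rightarrow> 'i \<Rightarrow> 'a \<Rightarrow> 'a) \<Rightarrow> 'a set set \<Rightarrow> nat \<Rightarrow> (nat \<Rightarrow> 'i) \<Rightarrow> nat \<Rightarrow> 'a set set" where
  "word_cover X \<phi> \<A> m w n = join_families n (\<lambda>j. pullback_family X (word_map \<phi> m w j) \<A>)"

text \<open>
  Only finite subcovers are considered, since \<open>card\<close> of an infinite set is 0. Open covers of a compact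
  space always have one, so the minimum is then attained.
\<close>

definition subcover_number :: "'a set \<Rightarrow> 'a set set \<Rightarrow> nat" where
  "subcover_number X \<A> = (LEAST n. \<exists>\<C>. \<C> \<subseteq> \<A> \<and> finite \<C> \<and> \<Union>\<C> = X \<and> card \<C> = n)"

definition cover_entropy ::
  "'a set \<Rightarrow> (nat \<Rightarrow> 'i set) \<Rightarrow> (nat \<Rightarrow> 'i \<Rightarrow> 'a \<Rightarrow> 'a) \<Rightarrow> nat \<Rightarrow> 'a set set \<Rightarrow> ereal" where
  "cover_entropy X I \<phi> m \<A> = limsup (\<lambda>k. ereal (1 / real k *
     ln (1 / real (card (words I m k)) *
         (\<Sum>w\<in>words I m k. real (subcover_number X (word_cover X \<phi> \<A> m w k))))))"

definition asymptotical_cover_entropy ::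
  "'a set \<Rightarrow> (nat \<Rightarrow> 'i set) \<Rightarrow> (nat \<Rightarrow> 'i \<Rightarrow> 'a \<Rightarrow> 'a) \<Rightarrow> 'a set set \<Rightarrow> ereal" where
  "asymptotical_cover_entropy X I \<phi> \<A> = lim (\<lambda>m. cover_entropy X I \<phi> m \<A>)"

definition asymptotical_entropy ::
  "'a::topological_space set \<Rightarrow> (nat \<Rightarrow> 'i set) \<Rightarrow> (nat \<Rightarrow> 'i \<Rightarrow> 'a \<Rightarrow> 'a) \<Rightarrow> ereal" where
  "asymptotical_entropy X I \<phi> = (SUP \<A>\<in>{\<A>. open_cover X \<A>}. asymptotical_cover_entropy X I \<phi> \<A>)"

definition topologically_chaotic ::
  "'a::topological_space set \<Rightarrow> (nat \<Rightarrow> 'i set) \<Rightarrow> (nat \<Rightarrow> 'i \<Rightarrow> 'a \<Rightarrow> 'a) \<Rightarrow> bool" where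
  "topologically_chaotic X I \<phi> \<longleftrightarrow> asymptotical_entropy X I \<phi> > 0"

definition specification_property ::
  "'a::metric_space set \<Rightarrow> (nat \<Rightarrow> 'i set) \<Rightarrow> (nat \<Rightarrow> 'i \<Rightarrow> 'a \<Rightarrow> 'a) \<Rightarrow> bool" where
  "specification_property X I \<phi> \<longleftrightarrow>
     (\<forall>\<delta>>0. \<exists>N::nat. \<forall>w\<in>inf_words I 1. \<forall>s\<ge>2. \<forall>(x::nat \<Rightarrow> 'a) (j::nat \<Rightarrow> nat) (k::nat \<Rightarrow> nat).
        (\<forall>n\<in>{1..s}. x n \<in> X) \<longrightarrow>
        j 1 = 0 \<longrightarrow>
        (\<forall>n\<in>{1..s}. j n \<le> k n) \<longrightarrow>
        (\<forall>n\<in>{1..<s}. k n < j (n + 1)) \<longrightarrow>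
        (\<forall>n\<in>{1..<s}. j (n + 1) - k n \<ge> N) \<longrightarrow>
        (\<exists>z\<in>X. \<forall>n\<in>{1..s}. \<forall>i\<in>{j n..k n}.
           dist (word_map \<phi> 1 w i z) (word_map \<phi> 1 w i (x n)) \<le> \<delta>))"

end

theory Submission
  imports Defs
begin

text \<open>
  The entropy is already positive at level 1, for a cover by two sets. Fix two points \<open>a \<noteq> b\<close> of
  \<open>X\<close>, a radius \<open>\<delta>\<close> with \<open>2 * \<delta> < dist a b\<close>, and let \<open>\<A>\<close> consist of the complements of the two
  disjoint closed \<open>\<delta>\<close>-balls around \<open>a\<close> and \<open>b\<close>. Use the specification property with every time
  block reduced to one instant, the instants being \<open>0, N, 2 * N, \<dots>\<close>. As the maps are surjective, the
  orbit that is shadowed in the \<open>n\<close>-th block can be made to pass through any given point at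
  time \<open>n * N\<close>. So along every word each sequence of choices between \<open>a\<close> and \<open>b\<close> is
  realised, up to \<open>\<delta>\<close>, by one orbit sampled at multiples of \<open>N\<close>
  (\<open>specification_hits_targets\<close>). A member of \<open>\<A>\<close> cannot contain points of both balls, so
  points that realise different choices lie in different members of the joined cover. Up to time
  \<open>k\<close> there are \<open>k div N + 1\<close> choices, so the joined cover needs at least \<open>2 ^ (k div N + 1)\<close> members
  to cover \<open>X\<close>, whatever the word (\<open>subcover_number_ge_itineraries\<close>), and the entropy of
  \<open>\<A>\<close> at level 1 is at least \<open>ln 2 / N\<close>.

  To pass to the limit over the levels, note that the first map of a word costs only a factor
  independent of its length, namely the number of members needed from \<open>\<A>\<close> at time 0
  (\<open>subcover_number_word_cover_Suc\<close>). This factor vanishes in the exponential growth rate, so the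
  entropies do not decrease with the level (\<open>cover_entropy_le_Suc\<close>); hence they converge, to at least
  their value at level 1.
\<close>

section \<open>Compositions along words\<close>

lemma word_map_cong:
  assumes "\<And>j. m \<le> j \<Longrightarrow> j < m + k \<Longrightarrow> w j = w' j"
  shows "word_map \<phi> m w k = word_map \<phi> m w' k"
  using assms by (induction k) auto

lemma word_map_Suc_left:
  "word_map \<phi> m w (Suc k) = word_map \<phi> (Suc m) w k \<circ> \<phi> m (w m)"
  by (induction k) (auto simp: fun_eq_iff)

lemma word_map_in:
  assumes "\<And>j. m \<le> j \<Longrightarrow> j < m + k \<Longrightarrow> \<phi> j (w j) ` X \<subseteq> X" and "x \<in> X"
  shows "word_map \<phi> m w k x \<in> X"
  using assms by (induction k) (auto simp: image_subset_iff)

lemma word_map_image_eq: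
  assumes "\<And>j. m \<le> j \<Longrightarrow> j < m + k \<Longrightarrow> \<phi> j (w j) ` X = X"
  shows "word_map \<phi> m w k ` X = X"
  using assms
proof (induction k)
  case (Suc k)
  have "word_map \<phi> m w (Suc k) ` X = \<phi> (m + k) (w (m + k)) ` (word_map \<phi> m w k ` X)"
    by (simp add: image_comp)
  with Suc show ?case by simp
qed simp

lemma sum_words_Suc:
  fixes f :: "(nat \<Rightarrow> 'i) \<Rightarrow> real"
  shows "(\<Sum>w\<in>words I m (Suc k). f w) = (\<Sum>i\<in>I m. \<Sum>w\<in>words I (Suc m) k. f (w(m := i)))"
proof -
  have ivl: "{m..<m + Suc k} = insert m {Suc m..<Suc m + k}"
    by auto
  have inj: "inj_on (\<lambda>(y, g). g(m := y)) (I m \<times> words I (Suc m) k)"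
    unfolding words_def by (rule inj_combinator) simp
  have "words I m (Suc k) = (\<lambda>(y, g). g(m := y)) ` (I m \<times> words I (Suc m) k)"
    unfolding words_def ivl by (rule PiE_insert_eq)
  then have "(\<Sum>w\<in>words I m (Suc k). f w) = (\<Sum>(i, w)\<in>I m \<times> words I (Suc m) k. f (w(m := i)))"
    by (simp only: sum.reindex[OF inj]) (simp add: case_prod_unfold comp_def)
  then show ?thesis
    by (simp add: sum.cartesian_product)
qed

lemma finite_words:
  assumes "naifs X I \<phi>" and "1 \<le> m"
  shows "finite (words I m k)"
  using assms unfolding words_def naifs_def by (intro finite_PiE) auto

lemma words_nonempty:
  assumes "naifs X I \<phi>" and "1 \<le> m"
  shows "words I m k \<noteq> {}"
  using assms unfolding words_def naifs_def by (auto simp: PiE_eq_empty_iff)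

lemma naifs_maps_into:
  assumes "naifs X I \<phi>" and "1 \<le> m" and "w \<in> words I m k" and "m \<le> j" and "j < m + k"
  shows "\<phi> j (w j) ` X \<subseteq> X"
proof -
  have "w j \<in> I j"
    using assms by (auto simp: words_def PiE_def Pi_def)
  then show ?thesis
    using assms by (auto simp: naifs_def)
qed

text \<open>The specification property speaks of infinite words, the entropy of finite ones.\<close>

lemma extend_word:
  assumes "naifs X I \<phi>" and "w \<in> words I 1 k"
  obtains u where "u \<in> inf_words I 1" and "\<And>j. 1 \<le> j \<Longrightarrow> j < 1 + k \<Longrightarrow> u j = w j"
proof
  let ?u = "\<lambda>j. if j \<in> {1..<1 + k} then w j else if 1 \<le> j then SOME i. i \<in> I j else undefined"
  have "(SOME i. i \<in> I j) \<in> I j" if "1 \<le> j" for j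
    using assms(1) that by (auto simp: naifs_def some_in_eq)
  then show "?u \<in> inf_words I 1"
    using assms(2) by (auto simp: inf_words_def words_def PiE_def Pi_def extensional_def)
qed auto

section \<open>Minimal subcovers\<close>

lemma subcover_number_attained:
  assumes "finite \<A>" and "\<Union>\<A> = X"
  obtains \<C> where "\<C> \<subseteq> \<A>" and "finite \<C>" and "\<Union>\<C> = X" and "card \<C> = subcover_number X \<A>"
proof -
  let ?P = "\<lambda>n. \<exists>\<C>. \<C> \<subseteq> \<A> \<and> finite \<C> \<and> \<Union>\<C> = X \<and> card \<C> = n"
  have "?P (card \<A>)"
    using assms by blast
  then have "?P (LEAST n. ?P n)"
    by (rule LeastI)
  then show thesis
    using that unfolding subcover_number_def by blast
qed

lemma subcover_number_le_card:
  assumes "\<C> \<subseteq> \<A>" and "finite \<C>" and "\<Union>\<C> = X"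
  shows "subcover_number X \<A> \<le> card \<C>"
  unfolding subcover_number_def by (rule Least_le) (use assms in blast)

lemma subcover_number_pos:
  assumes "finite \<A>" and "\<Union>\<A> = X" and "X \<noteq> {}"
  shows "1 \<le> subcover_number X \<A>"
proof -
  obtain \<C> where "finite \<C>" "\<Union>\<C> = X" "card \<C> = subcover_number X \<A>"
    using subcover_number_attained[OF assms(1,2)] by metis
  then show ?thesis
    using assms(3) by (metis One_nat_def Suc_leI Union_empty card_gt_0_iff)
qed

section \<open>Joined covers along words\<close>

lemma word_cover_cong:
  assumes "\<And>j. m \<le> j \<Longrightarrow> j < m + k \<Longrightarrow> w j = w' j"
  shows "word_cover X \<phi> \<A> m w k = word_cover X \<phi> \<A> m w' k"
proof -
  have "word_map \<phi> m w j = word_map \<phi> m w' j" if "j \<le> k" for j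
    using assms that by (intro word_map_cong) auto
  then show ?thesis
    by (auto simp: word_cover_def join_families_def)
qed

lemma finite_word_cover:
  assumes "finite \<A>"
  shows "finite (word_cover X \<phi> \<A> m w k)"
proof -
  let ?F = "\<lambda>j. pullback_family X (word_map \<phi> m w j) \<A>"
  have "word_cover X \<phi> \<A> m w k \<subseteq> (\<lambda>B. \<Inter>j\<le>k. B j) ` PiE {..k} ?F"
  proof
    fix C assume "C \<in> word_cover X \<phi> \<A> m w k"
    then obtain B where "C = (\<Inter>j\<le>k. B j)" "\<forall>j\<le>k. B j \<in> ?F j"
      by (auto simp: word_cover_def join_families_def)
    then have "C = (\<Inter>j\<le>k. restrict B {..k} j)" "restrict B {..k} \<in> PiE {..k} ?F"
      by auto
    then show "C \<in> (\<lambda>B. \<Inter>j\<le>k. B j) ` PiE {..k} ?F"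
      by blast
  qed
  moreover have "finite (PiE {..k} ?F)"
    using assms by (intro finite_PiE) (auto simp: pullback_family_def)
  ultimately show ?thesis
    by (meson finite_imageI finite_subset)
qed

lemma mem_word_coverI:
  assumes "\<And>j. j \<le> k \<Longrightarrow> A j \<in> \<A>"
  shows "(\<Inter>j\<le>k. word_map \<phi> m w j -` A j \<inter> X) \<in> word_cover X \<phi> \<A> m w k"
  using assms unfolding word_cover_def join_families_def pullback_family_def by blast

lemma mem_word_coverD:
  assumes "C \<in> word_cover X \<phi> \<A> m w k"
  shows "\<exists>A. (\<forall>j\<le>k. A j \<in> \<A>) \<and> C = (\<Inter>j\<le>k. word_map \<phi> m w j -` A j \<inter> X)"
proof -
  obtain B where C: "C = (\<Inter>j\<le>k. B j)"
    and B: "\<forall>j\<le>k. B j \<in> pullback_family X (word_map \<phi> m w j) \<A>"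
    using assms by (auto simp: word_cover_def join_families_def)
  from B have "\<forall>j\<in>{..k}. \<exists>A. A \<in> \<A> \<and> B j = word_map \<phi> m w j -` A \<inter> X"
    by (auto simp: pullback_family_def)
  from bchoice[OF this] obtain A
    where "\<forall>j\<in>{..k}. A j \<in> \<A> \<and> B j = word_map \<phi> m w j -` A j \<inter> X"
    by blast
  then have "(\<forall>j\<le>k. A j \<in> \<A>) \<and> C = (\<Inter>j\<le>k. word_map \<phi> m w j -` A j \<inter> X)"
    using C by auto
  then show ?thesis
    by blast
qed

lemma Union_word_cover:
  assumes "\<Union>\<A> = X" and "\<And>j. m \<le> j \<Longrightarrow> j < m + k \<Longrightarrow> \<phi> j (w j) ` X \<subseteq> X"
  shows "\<Union>(word_cover X \<phi> \<A> m w k) = X"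
proof
  show "\<Union>(word_cover X \<phi> \<A> m w k) \<subseteq> X"
    by (auto dest!: mem_word_coverD)
  show "X \<subseteq> \<Union>(word_cover X \<phi> \<A> m w k)"
  proof
    fix x assume x: "x \<in> X"
    have "word_map \<phi> m w j x \<in> X" if "j \<le> k" for j
      using assms(2) that x by (intro word_map_in) auto
    then have "\<forall>j\<in>{..k}. \<exists>A. A \<in> \<A> \<and> word_map \<phi> m w j x \<in> A"
      using assms(1) by blast
    from bchoice[OF this] obtain A
      where A: "\<forall>j\<in>{..k}. A j \<in> \<A> \<and> word_map \<phi> m w j x \<in> A j"
      by blast
    then have "x \<in> (\<Inter>j\<le>k. word_map \<phi> m w j -` A j \<inter> X)"
      using x by auto
    moreover have "(\<Inter>j\<le>k. word_map \<phi> m w j -` A j \<inter> X) \<in> word_cover X \<phi> \<A> m w k"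
      using A by (intro mem_word_coverI) auto
    ultimately show "x \<in> \<Union>(word_cover X \<phi> \<A> m w k)"
      by blast
  qed
qed

text \<open>
  A subcover of the join over the times \<open>1, \<dots>, k + 1\<close> is obtained by pulling back, along the first
  map, a subcover for the word without its first letter. Joining it with a subcover of \<open>\<A>\<close> accounts
  for time 0.
\<close>

lemma subcover_number_word_cover_Suc:
  assumes "finite \<A>" and "\<Union>\<A> = X"
    and maps: "\<And>j. m \<le> j \<Longrightarrow> j < m + Suc k \<Longrightarrow> \<phi> j (w j) ` X \<subseteq> X"
  shows "subcover_number X (word_cover X \<phi> \<A> m w (Suc k))
           \<le> subcover_number X \<A> * subcover_number X (word_cover X \<phi> \<A> (Suc m) w k)"
proof -
  obtain \<C> where \<C>: "\<C> \<subseteq> \<A>" "finite \<C>" "\<Union>\<C> = X" "card \<C> = subcover_number X \<A>"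
    using subcover_number_attained[OF assms(1,2)] by metis
  have "\<Union>(word_cover X \<phi> \<A> (Suc m) w k) = X"
    using assms by (intro Union_word_cover) auto
  then obtain \<D> where \<D>: "\<D> \<subseteq> word_cover X \<phi> \<A> (Suc m) w k" "finite \<D>" "\<Union>\<D> = X"
      "card \<D> = subcover_number X (word_cover X \<phi> \<A> (Suc m) w k)"
    using subcover_number_attained[OF finite_word_cover[OF assms(1)]] by metis
  let ?f = "\<phi> m (w m)"
  have f: "?f ` X \<subseteq> X"
    by (rule maps) auto
  let ?E = "(\<lambda>(C, D). C \<inter> (?f -` D \<inter> X)) ` (\<C> \<times> \<D>)"
  have "?E \<subseteq> word_cover X \<phi> \<A> m w (Suc k)"
  proof clarify
    fix C D assume C: "C \<in> \<C>" and "D \<in> \<D>"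
    then have "D \<in> word_cover X \<phi> \<A> (Suc m) w k"
      using \<D>(1) by blast
    from mem_word_coverD[OF this] obtain A where A: "\<forall>j\<le>k. A j \<in> \<A>"
      and D: "D = (\<Inter>j\<le>k. word_map \<phi> (Suc m) w j -` A j \<inter> X)"
      by blast
    let ?A = "case_nat C A"
    have "C \<inter> (?f -` D \<inter> X) = (\<Inter>j\<le>Suc k. word_map \<phi> m w j -` ?A j \<inter> X)" (is "_ = ?R")
    proof -
      have "?R = (word_map \<phi> m w 0 -` C \<inter> X) \<inter> (\<Inter>j\<le>k. word_map \<phi> m w (Suc j) -` A j \<inter> X)"
        unfolding atMost_Suc_eq_insert_0 by simp
      also have "\<dots> = C \<inter> (?f -` D \<inter> X)"
        unfolding D word_map_Suc_left using f by (auto simp del: word_map.simps(2))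
      finally show ?thesis by simp
    qed
    moreover have "?R \<in> word_cover X \<phi> \<A> m w (Suc k)"
      using A C \<C>(1) by (intro mem_word_coverI) (auto split: nat.split)
    ultimately show "C \<inter> (?f -` D \<inter> X) \<in> word_cover X \<phi> \<A> m w (Suc k)"
      by simp
  qed
  moreover have "\<Union>?E = X"
  proof
    show "X \<subseteq> \<Union>?E"
    proof
      fix x assume x: "x \<in> X"
      then have "?f x \<in> X"
        using f by blast
      with x obtain C D where "C \<in> \<C>" "x \<in> C" "D \<in> \<D>" "?f x \<in> D"
        using \<C>(3) \<D>(3) by (metis UnionE)
      with x show "x \<in> \<Union>?E"
        by blast
    qed
  qed auto
  moreover have "finite ?E"
    using \<C>(2) \<D>(2) by simp
  ultimately have "subcover_number X (word_cover X \<phi> \<A> m w (Suc k)) \<le> card ?E"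
    by (intro subcover_number_le_card)
  also have "\<dots> \<le> card (\<C> \<times> \<D>)"
    using \<C>(2) \<D>(2) by (intro card_image_le) simp
  finally show ?thesis
    using \<C>(4) \<D>(4) by (simp add: card_cartesian_product)
qed

section \<open>Monotonicity of the entropy in the level\<close>

definition mean_subcover_number ::
  "'a set \<Rightarrow> (nat \<Rightarrow> 'i set) \<Rightarrow> (nat \<Rightarrow> 'i \<Rightarrow> 'a \<Rightarrow> 'a) \<Rightarrow> 'a set set \<Rightarrow> nat \<Rightarrow> nat \<Rightarrow> real" where
  "mean_subcover_number X I \<phi> \<A> m k = 1 / real (card (words I m k)) *
     (\<Sum>w\<in>words I m k. real (subcover_number X (word_cover X \<phi> \<A> m w k)))"

lemma mean_subcover_number_ge:
  assumes "naifs X I \<phi>" and "1 \<le> m"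
    and "\<And>w. w \<in> words I m k \<Longrightarrow> b \<le> real (subcover_number X (word_cover X \<phi> \<A> m w k))"
  shows "b \<le> mean_subcover_number X I \<phi> \<A> m k"
proof -
  have "0 < card (words I m k)"
    using finite_words[OF assms(1,2)] words_nonempty[OF assms(1,2)] by (simp add: card_gt_0_iff)
  moreover have "real (card (words I m k)) * b
      \<le> (\<Sum>w\<in>words I m k. real (subcover_number X (word_cover X \<phi> \<A> m w k)))"
    by (rule sum_bounded_below) (use assms(3) in simp)
  ultimately show ?thesis
    by (simp add: mean_subcover_number_def field_simps)
qed

lemma mean_subcover_number_ge_1:
  assumes "naifs X I \<phi>" and "1 \<le> m" and "X \<noteq> {}" and "finite \<A>" and "\<Union>\<A> = X"
  shows "1 \<le> mean_subcover_number X I \<phi> \<A> m k"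
proof (rule mean_subcover_number_ge[OF assms(1,2)])
  fix w assume w: "w \<in> words I m k"
  have "\<Union>(word_cover X \<phi> \<A> m w k) = X"
    using naifs_maps_into[OF assms(1,2) w] by (intro Union_word_cover assms(5))
  then show "1 \<le> real (subcover_number X (word_cover X \<phi> \<A> m w k))"
    using subcover_number_pos[OF finite_word_cover[OF assms(4)] _ assms(3)] by simp
qed

lemma mean_subcover_number_Suc:
  assumes "naifs X I \<phi>" and "1 \<le> m" and "finite \<A>" and "\<Union>\<A> = X"
  shows "mean_subcover_number X I \<phi> \<A> m (Suc k)
           \<le> real (subcover_number X \<A>) * mean_subcover_number X I \<phi> \<A> (Suc m) k"
proof -
  let ?N = "\<lambda>m w k. real (subcover_number X (word_cover X \<phi> \<A> m w k))"
  have I: "0 < real (card (I m))"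
    using assms(1,2) by (simp add: naifs_def card_gt_0_iff)
  have card: "real (card (words I m (Suc k))) = real (card (I m)) * real (card (words I (Suc m) k))"
    using sum_words_Suc[of "\<lambda>_. 1" I m k] by simp
  have "?N m (w(m := i)) (Suc k) \<le> real (subcover_number X \<A>) * ?N (Suc m) w k"
    if "i \<in> I m" "w \<in> words I (Suc m) k" for i w
  proof -
    have "w(m := i) \<in> words I m (Suc k)"
      using that by (auto simp: words_def PiE_def Pi_def extensional_def)
    then have "subcover_number X (word_cover X \<phi> \<A> m (w(m := i)) (Suc k))
        \<le> subcover_number X \<A> * subcover_number X (word_cover X \<phi> \<A> (Suc m) (w(m := i)) k)"
      using naifs_maps_into[OF assms(1,2)] by (intro subcover_number_word_cover_Suc assms) blast
    moreover have "word_cover X \<phi> \<A> (Suc m) (w(m := i)) k = word_cover X \<phi> \<A> (Suc m) w k"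
      by (rule word_cover_cong) auto
    ultimately show ?thesis
      by (metis of_nat_le_iff of_nat_mult)
  qed
  then have "(\<Sum>w\<in>words I m (Suc k). ?N m w (Suc k))
      \<le> (\<Sum>i\<in>I m. \<Sum>w\<in>words I (Suc m) k. real (subcover_number X \<A>) * ?N (Suc m) w k)"
    unfolding sum_words_Suc by (intro sum_mono)
  also have "\<dots> = real (card (I m)) *
      (real (subcover_number X \<A>) * (\<Sum>w\<in>words I (Suc m) k. ?N (Suc m) w k))"
    by (simp add: sum_distrib_left)
  finally have "mean_subcover_number X I \<phi> \<A> m (Suc k)
      \<le> 1 / (real (card (I m)) * real (card (words I (Suc m) k))) * (real (card (I m)) *
      (real (subcover_number X \<A>) * (\<Sum>w\<in>words I (Suc m) k. ?N (Suc m) w k)))"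
    unfolding mean_subcover_number_def card by (intro mult_left_mono) auto
  also have "\<dots> = real (subcover_number X \<A>) * mean_subcover_number X I \<phi> \<A> (Suc m) k"
    using I by (simp add: mean_subcover_number_def)
  finally show ?thesis .
qed

lemma cover_entropy_eq_limsup_mean:
  "cover_entropy X I \<phi> m \<A> = limsup (\<lambda>k. ereal (1 / real k * ln (mean_subcover_number X I \<phi> \<A> m k)))"
  by (simp add: cover_entropy_def mean_subcover_number_def)

text \<open>
  Prefixing a letter raises the mean by a factor at most \<open>subcover_number X \<A>\<close>, hence the growth
  rate over \<open>k\<close> steps by a term of order \<open>1 / k\<close>.
\<close>

lemma cover_entropy_le_Suc:
  assumes "naifs X I \<phi>" and "1 \<le> m" and "X \<noteq> {}" and "finite \<A>" and "\<Union>\<A> = X"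
  shows "cover_entropy X I \<phi> m \<A> \<le> cover_entropy X I \<phi> (Suc m) \<A>"
proof -
  let ?S = "mean_subcover_number X I \<phi> \<A>"
  let ?r = "\<lambda>m k. ereal (1 / real k * ln (?S m k))"
  let ?c = "ln (real (subcover_number X \<A>))"
  have N: "1 \<le> real (subcover_number X \<A>)"
    using subcover_number_pos[OF assms(4,5,3)] by simp
  have S1: "1 \<le> ?S m' k" if "1 \<le> m'" for m' k
    using mean_subcover_number_ge_1[OF assms(1) that assms(3-5)] .
  have bound: "?r m (Suc k) \<le> ereal (?c / real k) + ?r (Suc m) k" if "1 \<le> k" for k
  proof -
    have S: "1 \<le> ?S m (Suc k)" "1 \<le> ?S (Suc m) k"
      using assms(2) by (simp_all add: S1)
    have "ln (?S m (Suc k)) \<le> ln (real (subcover_number X \<A>) * ?S (Suc m) k)"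
      using mean_subcover_number_Suc[OF assms(1,2,4,5), of k] S by (intro ln_mono) auto
    also have "\<dots> = ?c + ln (?S (Suc m) k)"
      using N S by (intro ln_mult_pos) auto
    finally have ln: "ln (?S m (Suc k)) \<le> ?c + ln (?S (Suc m) k)" .
    have "1 / real (Suc k) * ln (?S m (Suc k)) \<le> 1 / real k * ln (?S m (Suc k))"
      using S that by (intro mult_right_mono) (auto simp: field_simps)
    also have "\<dots> \<le> 1 / real k * (?c + ln (?S (Suc m) k))"
      using ln by (intro mult_left_mono) auto
    finally show ?thesis
      by (simp add: field_simps add_divide_distrib)
  qed
  have "cover_entropy X I \<phi> m \<A> = limsup (\<lambda>k. ?r m (Suc k))"
    unfolding cover_entropy_eq_limsup_mean using limsup_shift[of "?r m"] by simp
  also have "\<dots> \<le> limsup (\<lambda>k. ereal (?c / real k) + ?r (Suc m) k)"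
    by (rule Limsup_mono) (use bound in \<open>auto simp: eventually_sequentially\<close>)
  also have "\<dots> = 0 + limsup (?r (Suc m))"
  proof (rule ereal_limsup_lim_add)
    have "(\<lambda>k. ?c / real k) \<longlonglongrightarrow> 0"
      by (rule lim_const_over_n)
    then show "(\<lambda>k. ereal (?c / real k)) \<longlonglongrightarrow> 0"
      by (simp add: zero_ereal_def)
  qed simp
  finally show ?thesis
    by (simp add: cover_entropy_eq_limsup_mean)
qed

lemma cover_entropy_le_asymptotical:
  assumes "naifs X I \<phi>" and "1 \<le> m" and "X \<noteq> {}" and "finite \<A>" and "\<Union>\<A> = X"
  shows "cover_entropy X I \<phi> m \<A> \<le> asymptotical_cover_entropy X I \<phi> \<A>"
proof -
  let ?h = "\<lambda>n. cover_entropy X I \<phi> n \<A>"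
  \<comment> \<open>Shifted by \<open>m\<close>, since level 0 is not controlled.\<close>
  have inc: "incseq (\<lambda>n. ?h (n + m))"
    using assms(2) by (intro incseq_SucI) (auto intro!: cover_entropy_le_Suc assms)
  define L where "L = (SUP n. ?h (n + m))"
  have L: "(\<lambda>n. ?h (n + m)) \<longlonglongrightarrow> L"
    unfolding L_def by (rule LIMSEQ_SUP[OF inc])
  then have "?h \<longlonglongrightarrow> L"
    by (rule LIMSEQ_offset)
  then have "asymptotical_cover_entropy X I \<phi> \<A> = L"
    unfolding asymptotical_cover_entropy_def by (rule limI)
  with incseq_le[OF inc L, of 0] show ?thesis
    by simp
qed

section \<open>Specification produces independent itineraries\<close>

text \<open>
  Surjectivity turns the shadowing of orbits into the approximation of prescribed points: the orbit
  to be shadowed around time \<open>n * N\<close> starts at a preimage of the target \<open>c n\<close>.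
\<close>

lemma specification_hits_targets:
  assumes "surjective_maps X I \<phi>" and "specification_property X I \<phi>" and "0 < \<delta>"
  shows "\<exists>N>0. \<forall>u\<in>inf_words I 1. \<forall>c s. (\<forall>n. c n \<in> X) \<longrightarrow>
           (\<exists>z\<in>X. \<forall>n\<le>s. dist (word_map \<phi> 1 u (n * N) z) (c n) \<le> \<delta>)"
proof -
  from assms(2)[unfolded specification_property_def, THEN spec, THEN mp, OF assms(3)]
  obtain N0 where N0: "\<forall>u\<in>inf_words I 1. \<forall>s\<ge>2. \<forall>(x::nat \<Rightarrow> 'a) (j::nat \<Rightarrow> nat) (k::nat \<Rightarrow> nat).
        (\<forall>n\<in>{1..s}. x n \<in> X) \<longrightarrow> j 1 = 0 \<longrightarrow> (\<forall>n\<in>{1..s}. j n \<le> k n) \<longrightarrow>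
        (\<forall>n\<in>{1..<s}. k n < j (n + 1)) \<longrightarrow> (\<forall>n\<in>{1..<s}. j (n + 1) - k n \<ge> N0) \<longrightarrow>
        (\<exists>z\<in>X. \<forall>n\<in>{1..s}. \<forall>i\<in>{j n..k n}.
           dist (word_map \<phi> 1 u i z) (word_map \<phi> 1 u i (x n)) \<le> \<delta>)" ..
  \<comment> \<open>The separation given by the specification property may be 0; the sampling times must differ.\<close>
  define N where "N = Suc N0"
  show ?thesis
  proof (intro exI[of _ N] conjI ballI allI impI)
    show "0 < N"
      by (simp add: N_def)
    fix u and c :: "nat \<Rightarrow> 'a" and s :: nat
    assume u: "u \<in> inf_words I 1" and c: "\<forall>n. c n \<in> X"
    have "word_map \<phi> 1 u t ` X = X" for t
      using assms(1) u
      by (intro word_map_image_eq) (auto simp: surjective_maps_def inf_words_def PiE_def Pi_def)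
    then have "\<forall>n. \<exists>x\<in>X. word_map \<phi> 1 u (n * N) x = c n"
      using c by (metis imageE)
    then obtain x where x: "\<And>n. x n \<in> X" "\<And>n. word_map \<phi> 1 u (n * N) (x n) = c n"
      by metis
    let ?j = "\<lambda>n. (n - 1) * N"
    \<comment> \<open>Blocks are numbered from 1, targets from 0. The block after the last target makes the number
      of blocks at least 2 when there is a single target.\<close>
    have "\<exists>z\<in>X. \<forall>n\<in>{1..s + 2}. \<forall>i\<in>{?j n..?j n}.
        dist (word_map \<phi> 1 u i z) (word_map \<phi> 1 u i (x (n - 1))) \<le> \<delta>"
    proof (rule N0[rule_format, OF u])
      have "?j (n + 1) = ?j n + N" if "1 \<le> n" for n
        using that by (cases n) auto
      then show "?j n < ?j (n + 1)" "N0 \<le> ?j (n + 1) - ?j n" if "n \<in> {1..<s + 2}" for n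
        using that by (auto simp: N_def)
    qed (use x(1) in auto)
    then obtain z where z: "z \<in> X" "\<And>n. n \<in> {1..s + 2} \<Longrightarrow>
        dist (word_map \<phi> 1 u (?j n) z) (word_map \<phi> 1 u (?j n) (x (n - 1))) \<le> \<delta>"
      by auto
    have "dist (word_map \<phi> 1 u (n * N) z) (c n) \<le> \<delta>" if "n \<le> s" for n
      using z(2)[of "Suc n"] that x(2)[of n] by simp
    with z(1) show "\<exists>z\<in>X. \<forall>n\<le>s. dist (word_map \<phi> 1 u (n * N) z) (c n) \<le> \<delta>"
      by blast
  qed
qed

text \<open>
  Itineraries are encoded by the set \<open>T\<close> of indices \<open>n\<close> at which the orbit is near \<open>a\<close> at time
  \<open>n * N\<close>; at the other indices it is near \<open>b\<close>. In a subcover, two points with different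
  itineraries never share a member, so the subcover has at least as many members as there are
  sets \<open>T\<close>.
\<close>

lemma subcover_number_ge_itineraries:
  fixes a b :: "'a::metric_space"
  assumes \<A>: "\<A> = {X - cball a \<delta>, X - cball b \<delta>}"
    and cover: "\<Union>(word_cover X \<phi> \<A> m w k) = X"
    and hits: "\<And>T. \<exists>z\<in>X. \<forall>n\<le>k div N.
           dist (word_map \<phi> m w (n * N) z) (if n \<in> T then a else b) \<le> \<delta>"
  shows "2 ^ Suc (k div N) \<le> subcover_number X (word_cover X \<phi> \<A> m w k)"
proof -
  let ?W = "word_cover X \<phi> \<A> m w k"
  have "finite ?W"
    by (rule finite_word_cover) (simp add: \<A>)
  with cover obtain \<C> where \<C>: "\<C> \<subseteq> ?W" "finite \<C>" "\<Union>\<C> = X" "card \<C> = subcover_number X ?W"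
    using subcover_number_attained by metis
  have "\<forall>T. \<exists>z. z \<in> X \<and>
      (\<forall>n\<le>k div N. dist (word_map \<phi> m w (n * N) z) (if n \<in> T then a else b) \<le> \<delta>)"
    using hits by blast
  from choice[OF this] obtain z where z: "\<And>T. z T \<in> X"
    "\<And>T n. n \<le> k div N \<Longrightarrow> dist (word_map \<phi> m w (n * N) (z T)) (if n \<in> T then a else b) \<le> \<delta>"
    by blast
  have "\<forall>T. \<exists>C. C \<in> \<C> \<and> z T \<in> C"
    using z(1) \<C>(3) by blast
  from choice[OF this] obtain M where M: "\<And>T. M T \<in> \<C>" "\<And>T. z T \<in> M T"
    by blast
  have agree: "n \<in> T \<longleftrightarrow> n \<in> T'" if "M T = M T'" "n \<le> k div N" for n T T'
  proof (rule ccontr)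
    assume differ: "\<not> (n \<in> T \<longleftrightarrow> n \<in> T')"
    have "n * N \<le> k"
      using that(2) by (metis mult_le_mono1 div_times_less_eq_dividend order_trans)
    moreover have "M T \<in> ?W"
      using M(1) \<C>(1) by blast
    from mem_word_coverD[OF this] obtain A where "\<forall>j\<le>k. A j \<in> \<A>"
      "M T = (\<Inter>j\<le>k. word_map \<phi> m w j -` A j \<inter> X)"
      by blast
    ultimately have "A (n * N) \<in> \<A>"
      "word_map \<phi> m w (n * N) (z T) \<in> A (n * N)" "word_map \<phi> m w (n * N) (z T') \<in> A (n * N)"
      using M(2)[of T] M(2)[of T'] that(1) by auto
    with z(2)[OF that(2), of T] z(2)[OF that(2), of T'] differ show False
      by (auto simp: \<A> dist_commute split: if_splits)
  qed
  have "inj_on M (Pow {..k div N})"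
  proof (rule inj_onI)
    fix T T' assume "T \<in> Pow {..k div N}" "T' \<in> Pow {..k div N}" "M T = M T'"
    with agree show "T = T'"
      by (metis PowD atMost_iff subsetD subsetI subset_antisym)
  qed
  then have "card (Pow {..k div N}) \<le> card \<C>"
    using M(1) \<C>(2) by (intro card_inj_on_le) auto
  then show ?thesis
    using \<C>(4) by (simp add: card_Pow)
qed

section \<open>Positive entropy\<close>

theorem corollary4p6:
  fixes X :: "'a::metric_space set"
    and I :: "nat \<Rightarrow> 'i set"
    and \<phi> :: "nat \<Rightarrow> 'i \<Rightarrow> 'a \<Rightarrow> 'a"
  assumes "X \<noteq> {}"
    and "naifs X I \<phi>"
    and "surjective_maps X I \<phi>"
    and "\<forall>x\<in>X. x islimpt X"
    and "specification_property X I \<phi>"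
  shows "asymptotical_entropy X I \<phi> > 0 \<and> topologically_chaotic X I \<phi>"
proof -
  obtain a where a: "a \<in> X"
    using assms(1) by blast
  with assms(4) obtain b where b: "b \<in> X" "b \<noteq> a"
    by (meson UNIV_I islimpt_def open_UNIV)
  define \<delta> where "\<delta> = dist a b / 3"
  have \<delta>: "0 < \<delta>"
    using b(2) by (simp add: \<delta>_def)
  define \<A> where "\<A> = {X - cball a \<delta>, X - cball b \<delta>}"
  have "openin (top_of_set X) (X - cball p \<delta>)" for p
    by (simp add: Diff_eq openin_open_Int open_Compl)
  moreover have "cball a \<delta> \<inter> cball b \<delta> = {}"
  proof -
    have "\<not> (dist a x \<le> \<delta> \<and> dist b x \<le> \<delta>)" for x
      using dist_triangle2[of a b x] \<delta> unfolding \<delta>_def by linarith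
    then show ?thesis
      by auto
  qed
  then have Union: "\<Union>\<A> = X"
    by (auto simp: \<A>_def)
  ultimately have cover: "open_cover X \<A>"
    by (auto simp: open_cover_def \<A>_def)
  from specification_hits_targets[OF assms(3,5) \<delta>]
  obtain N where N: "0 < N" "\<forall>u\<in>inf_words I 1. \<forall>c s. (\<forall>n. c n \<in> X) \<longrightarrow>
      (\<exists>z\<in>X. \<forall>n\<le>s. dist (word_map \<phi> 1 u (n * N) z) (c n) \<le> \<delta>)"
    by blast
  have number: "2 ^ Suc (k div N) \<le> subcover_number X (word_cover X \<phi> \<A> 1 w k)"
    if w: "w \<in> words I 1 k" for w k
  proof -
    obtain u where u: "u \<in> inf_words I 1" "\<And>j. 1 \<le> j \<Longrightarrow> j < 1 + k \<Longrightarrow> u j = w j"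
      using extend_word[OF assms(2) w] by metis
    have word_map: "word_map \<phi> 1 u (n * N) = word_map \<phi> 1 w (n * N)" if "n \<le> k div N" for n
    proof -
      have "n * N \<le> k"
        using that by (metis mult_le_mono1 div_times_less_eq_dividend order_trans)
      then show ?thesis
        using u(2) by (intro word_map_cong) auto
    qed
    have "\<exists>z\<in>X. \<forall>n\<le>k div N. dist (word_map \<phi> 1 w (n * N) z) (if n \<in> T then a else b) \<le> \<delta>" for T
    proof -
      have "\<exists>z\<in>X. \<forall>n\<le>k div N. dist (word_map \<phi> 1 u (n * N) z) (if n \<in> T then a else b) \<le> \<delta>"
        by (rule N(2)[rule_format, OF u(1)]) (simp add: a b(1))
      then show ?thesis
        using word_map by metis
    qed
    moreover have "\<Union>(word_cover X \<phi> \<A> 1 w k) = X"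
      using naifs_maps_into[OF assms(2) order_refl w] by (intro Union_word_cover Union)
    ultimately show ?thesis
      by (intro subcover_number_ge_itineraries[OF \<A>_def])
  qed
  have rate: "ln 2 / real N \<le> 1 / real k * ln (mean_subcover_number X I \<phi> \<A> 1 k)" if "1 \<le> k" for k
  proof -
    have "k < Suc (k div N) * N"
      using N(1) by (simp add: dividend_less_div_times)
    then have "real k \<le> real (Suc (k div N)) * real N"
      by (metis less_imp_le of_nat_le_iff of_nat_mult)
    then have "real k / real N * ln 2 \<le> real (Suc (k div N)) * ln 2"
      using N(1) by (intro mult_right_mono) (auto simp: pos_divide_le_eq)
    also have "\<dots> = ln (2 ^ Suc (k div N))"
      by (simp add: ln_realpow del: power_Suc)
    also have "\<dots> \<le> ln (mean_subcover_number X I \<phi> \<A> 1 k)"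
    proof (rule ln_mono)
      show "2 ^ Suc (k div N) \<le> mean_subcover_number X I \<phi> \<A> 1 k"
        using number by (intro mean_subcover_number_ge[OF assms(2)])
          (simp_all del: power_Suc add: numeral_power_le_of_nat_cancel_iff)
    qed auto
    finally show ?thesis
      using that by (simp add: field_simps)
  qed
  have "0 < ereal (ln 2 / real N)"
    using N(1) by simp
  also have "\<dots> \<le> cover_entropy X I \<phi> 1 \<A>"
    unfolding cover_entropy_eq_limsup_mean
    by (rule le_Limsup) (use rate in \<open>auto simp: eventually_sequentially\<close>)
  also have "\<dots> \<le> asymptotical_cover_entropy X I \<phi> \<A>"
    using assms(1,2) Union by (intro cover_entropy_le_asymptotical) (auto simp: \<A>_def)
  also have "\<dots> \<le> asymptotical_entropy X I \<phi>"
    unfolding asymptotical_entropy_def using cover by (intro SUP_upper) simp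
  finally show ?thesis
    by (simp add: topologically_chaotic_def)
qed

end
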